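(* There exists an archimedean $\ell$-group $G$ such that $G\in(\mathrm{M})$ and $G\notin(\mathrm{Y})$.
   Context: $\ell$-group means lattice-ordered group (written additively). $G$ is archimedean if whenever $a,b\ge 0$ and $na\le b$ for all $n\in\mathbb{N}$, then $a=0$. For $a\in G$, $G(a)=\{b\in G:|b|\le n|a|\text{ for some }n\in\mathbb{N}\}$ is the principal convex $\ell$-subgroup generated by $a$, and for $S\subseteq G$, $S^\perp=\{h\in G:|h|\wedge|s|=0\text{ for all }s\in S\}$. $G\in(\mathrm{M})$ means that every convex $\ell$-subgroup $H$ of $G$ satisfies $a^{\perp\perp}\subseteq H$ for all $a\in H$; equivalently $G(a)=a^{\perp\perp}$ for all $a\in G$. $G\in(\mathrm{Y})$ means that for every $a\in G$, $G(a)$ is an intersection of maximal (proper) convex $\ell$-subgroups of $G$ (the empty intersection being $G$). *)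

theory Defs
  imports Complex_Main "HOL-Algebra.Group" "HOL-Algebra.Lattice"
begin

(* HOL-Algebra groups use multiplicative notation: a + b, 0, -a and n a appear below
   as a \<otimes> b, \<one>, inv a and a [^] n.  Commutativity is not part of the definition of an l-group. *)

record 'a lgroup = "'a monoid" +
  lg_le :: "'a \<Rightarrow> 'a \<Rightarrow> bool" (infixl \<open>\<preceq>\<index>\<close> 50)

definition order_of :: "('a, 'b) lgroup_scheme \<Rightarrow> 'a gorder" where
  "order_of G = \<lparr>carrier = carrier G, eq = (=), le = lg_le G\<rparr>"

abbreviation lg_join :: "('a, 'b) lgroup_scheme \<Rightarrow> 'a \<Rightarrow> 'a \<Rightarrow> 'a" where
  "lg_join G x y \<equiv> join (order_of G) x y"

abbreviation lg_meet :: "('a, 'b) lgroup_scheme \<Rightarrow> 'a \<Rightarrow> 'a \<Rightarrow> 'a" where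
  "lg_meet G x y \<equiv> meet (order_of G) x y"

locale l_group = group G for G (structure) +
  assumes lattice_order: "lattice (order_of G)"
    and translate_left:
      "\<lbrakk>x \<in> carrier G; y \<in> carrier G; z \<in> carrier G; x \<preceq> y\<rbrakk> \<Longrightarrow> z \<otimes> x \<preceq> z \<otimes> y"
    and translate_right:
      "\<lbrakk>x \<in> carrier G; y \<in> carrier G; z \<in> carrier G; x \<preceq> y\<rbrakk> \<Longrightarrow> x \<otimes> z \<preceq> y \<otimes> z"

definition lg_abs :: "('a, 'b) lgroup_scheme \<Rightarrow> 'a \<Rightarrow> 'a" where
  "lg_abs G x = lg_join G x (inv\<^bsub>G\<^esub> x)"

definition archimedean :: "('a, 'b) lgroup_scheme \<Rightarrow> bool" where
  "archimedean G \<longleftrightarrow>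
    (\<forall>a\<in>carrier G. \<forall>b\<in>carrier G.
      \<one>\<^bsub>G\<^esub> \<preceq>\<^bsub>G\<^esub> a \<and> \<one>\<^bsub>G\<^esub> \<preceq>\<^bsub>G\<^esub> b \<and> (\<forall>n::nat. a [^]\<^bsub>G\<^esub> n \<preceq>\<^bsub>G\<^esub> b) \<longrightarrow> a = \<one>\<^bsub>G\<^esub>)"

definition convex_l_subgroup :: "('a, 'b) lgroup_scheme \<Rightarrow> 'a set \<Rightarrow> bool" where
  "convex_l_subgroup G H \<longleftrightarrow>
    subgroup H G \<and>
    (\<forall>x\<in>H. \<forall>y\<in>H. lg_join G x y \<in> H \<and> lg_meet G x y \<in> H) \<and>
    (\<forall>x\<in>H. \<forall>z\<in>H. \<forall>y\<in>carrier G. x \<preceq>\<^bsub>G\<^esub> y \<and> y \<preceq>\<^bsub>G\<^esub> z \<longrightarrow> y \<in> H)"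

definition maximal_convex_l_subgroup :: "('a, 'b) lgroup_scheme \<Rightarrow> 'a set \<Rightarrow> bool" where
  "maximal_convex_l_subgroup G H \<longleftrightarrow>
    convex_l_subgroup G H \<and> H \<noteq> carrier G \<and>
    (\<forall>K. convex_l_subgroup G K \<and> K \<noteq> carrier G \<and> H \<subseteq> K \<longrightarrow> K = H)"

definition principal :: "('a, 'b) lgroup_scheme \<Rightarrow> 'a \<Rightarrow> 'a set" where
  "principal G a = {b \<in> carrier G. \<exists>n::nat. lg_abs G b \<preceq>\<^bsub>G\<^esub> lg_abs G a [^]\<^bsub>G\<^esub> n}"

definition perp :: "('a, 'b) lgroup_scheme \<Rightarrow> 'a set \<Rightarrow> 'a set" where
  "perp G S = {h \<in> carrier G. \<forall>s\<in>S. lg_meet G (lg_abs G h) (lg_abs G s) = \<one>\<^bsub>G\<^esub>}"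

definition property_M :: "('a, 'b) lgroup_scheme \<Rightarrow> bool" where
  "property_M G \<longleftrightarrow>
    (\<forall>H. convex_l_subgroup G H \<longrightarrow> (\<forall>a\<in>H. perp G (perp G {a}) \<subseteq> H))"

(* Intersecting with the carrier makes the empty intersection equal to G. *)
definition property_Y :: "('a, 'b) lgroup_scheme \<Rightarrow> bool" where
  "property_Y G \<longleftrightarrow>
    (\<forall>a\<in>carrier G. \<exists>\<M>. (\<forall>M\<in>\<M>. maximal_convex_l_subgroup G M) \<and>
      principal G a = carrier G \<inter> \<Inter>\<M>)"

end

theory Submission
  imports Defs "HOL-Library.Countable_Set"
begin

text \<open>
  The elements of the group are pairs of a function on the Cantor space, locally constant except for
  finitely many poles, and a real function on the (isolated) nodes of the binary tree.  A pole at \<open>y\<close>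
  of strength \<open>r\<close> forces the value \<open>r\<close> at almost all nodes on the branch \<open>y\<close>, and away from such
  branches the second component has finite support.  Where an element is nonzero it is therefore
  bounded away from zero and determines the possible poles of the elements in its double polar,
  which by compactness gives (M).  On the other hand the indicator \<open>1\<close> of the Cantor space lies in
  every maximal convex subgroup \<open>M\<close>: otherwise an element with a pole at \<open>y\<close> is bounded by \<open>m + k 1\<close>
  with \<open>m \<in> M\<close>, so that \<open>m\<close> dominates the indicator of a neighbourhood of \<open>y\<close>; finitely many such
  neighbourhoods cover the Cantor space, so \<open>1 \<in> M\<close> after all.  Hence \<open>G(0) = 0\<close> is not an
  intersection of maximal convex subgroups.

  A function on the Cantor space is encoded by its averages over the cones of the tree nodes, that
  is, by a harmonic function on the tree.  As the functions involved are integrable and continuous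
  off their poles, the order of the group becomes the pointwise order of real functions on a
  countable set.
\<close>

section \<open>Groups of real functions with the pointwise order\<close>

definition pointwise_group :: "('i \<Rightarrow> real) set \<Rightarrow> ('i \<Rightarrow> real) lgroup" where
  "pointwise_group C =
    \<lparr>carrier = C, monoid.mult = (\<lambda>f g i. f i + g i), one = (\<lambda>i. 0), lg_le = (\<le>)\<rparr>"

lemma pointwise_group_simps [simp]:
  "carrier (pointwise_group C) = C"
  "monoid.mult (pointwise_group C) f g = (\<lambda>i. f i + g i)"
  "one (pointwise_group C) = (\<lambda>i. 0)"
  "lg_le (pointwise_group C) f g \<longleftrightarrow> f \<le> g"
  by (simp_all add: pointwise_group_def)

lemma order_of_pointwise_group [simp]:
  "carrier (order_of (pointwise_group C)) = C"
  "eq (order_of (pointwise_group C)) = (=)"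
  "le (order_of (pointwise_group C)) = (\<le>)"
  by (simp_all add: order_of_def pointwise_group_def)

lemma pointwise_group_pow: "f [^]\<^bsub>pointwise_group C\<^esub> (n::nat) = (\<lambda>i. real n * f i)"
  by (induction n) (auto simp: algebra_simps)

lemma is_lub_pointwise_iff:
  assumes "f \<in> C" "g \<in> C"
  shows "is_lub (order_of (pointwise_group C)) j {f, g} \<longleftrightarrow>
    j \<in> C \<and> f \<le> j \<and> g \<le> j \<and> (\<forall>q\<in>C. f \<le> q \<and> g \<le> q \<longrightarrow> j \<le> q)"
  using assms by (auto simp: least_def Upper_def)

lemma is_glb_pointwise_iff:
  assumes "f \<in> C" "g \<in> C"
  shows "is_glb (order_of (pointwise_group C)) j {f, g} \<longleftrightarrow>
    j \<in> C \<and> j \<le> f \<and> j \<le> g \<and> (\<forall>q\<in>C. q \<le> f \<and> q \<le> g \<longrightarrow> q \<le> j)"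
  using assms by (auto simp: greatest_def Lower_def)

text \<open>For nonnegative members of \<open>C\<close> this says that their meet in
  \<open>C\<close> is zero. It is phrased through common lower bounds because that meet need not be
  the pointwise minimum.\<close>

definition disjoint_in :: "('i \<Rightarrow> real) set \<Rightarrow> ('i \<Rightarrow> real) \<Rightarrow> ('i \<Rightarrow> real) \<Rightarrow> bool" where
  "disjoint_in C f g \<longleftrightarrow> (\<forall>q\<in>C. (\<lambda>i. 0) \<le> q \<and> q \<le> f \<and> q \<le> g \<longrightarrow> q = (\<lambda>i. 0))"

lemma disjoint_in_commute: "disjoint_in C f g \<Longrightarrow> disjoint_in C g f"
  by (auto simp: disjoint_in_def)

text \<open>Only the join with zero is postulated, since translations produce all other joins and
  meets. It is formed inside \<open>C\<close> and may exceed the pointwise maximum, as happens for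
  harmonic functions.\<close>

locale pointwise_l_group =
  fixes C :: "('i \<Rightarrow> real) set"
  assumes zero_closed: "(\<lambda>i. 0) \<in> C"
    and diff_closed: "\<And>f g. \<lbrakk>f \<in> C; g \<in> C\<rbrakk> \<Longrightarrow> (\<lambda>i. f i - g i) \<in> C"
    and positive_part: "\<And>f. f \<in> C \<Longrightarrow>
      \<exists>p\<in>C. (\<lambda>i. 0) \<le> p \<and> f \<le> p \<and> (\<forall>q\<in>C. (\<lambda>i. 0) \<le> q \<and> f \<le> q \<longrightarrow> p \<le> q)"
begin

abbreviation "G \<equiv> pointwise_group C"

lemma neg_closed: "f \<in> C \<Longrightarrow> (\<lambda>i. - f i) \<in> C"
  using diff_closed[OF zero_closed, of f] by simp

lemma add_closed: "f \<in> C \<Longrightarrow> g \<in> C \<Longrightarrow> (\<lambda>i. f i + g i) \<in> C"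
  using diff_closed[of f "\<lambda>i. - g i"] neg_closed[of g] by simp

lemma scale_closed: "f \<in> C \<Longrightarrow> (\<lambda>i. real n * f i) \<in> C"
proof (induction n)
  case (Suc n)
  then show ?case using add_closed[of f "\<lambda>i. real n * f i"] by (simp add: algebra_simps)
qed (simp add: zero_closed)

text \<open>The join of \<open>f\<close> and \<open>g\<close> is the positive part of
  \<open>f - g\<close>, translated back by \<open>g\<close>.\<close>

lemma ex_lub:
  assumes "f \<in> C" "g \<in> C"
  shows "\<exists>j\<in>C. f \<le> j \<and> g \<le> j \<and> (\<forall>q\<in>C. f \<le> q \<and> g \<le> q \<longrightarrow> j \<le> q)"
proof -
  obtain p where p: "p \<in> C" "(\<lambda>i. 0) \<le> p" "(\<lambda>i. f i - g i) \<le> p"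
    "\<And>q. q \<in> C \<Longrightarrow> (\<lambda>i. 0) \<le> q \<Longrightarrow> (\<lambda>i. f i - g i) \<le> q \<Longrightarrow> p \<le> q"
    using positive_part[OF diff_closed[OF assms]] by blast
  have "(\<lambda>i. p i + g i) \<le> q" if "q \<in> C" "f \<le> q" "g \<le> q" for q
    using p(4)[OF diff_closed[OF that(1) assms(2)]] that by (auto simp: le_fun_def algebra_simps)
  then show ?thesis
    using p add_closed[OF p(1) assms(2)]
    by (intro bexI[of _ "\<lambda>i. p i + g i"]) (auto simp: le_fun_def algebra_simps)
qed

lemma ex_glb:
  assumes "f \<in> C" "g \<in> C"
  shows "\<exists>j\<in>C. j \<le> f \<and> j \<le> g \<and> (\<forall>q\<in>C. q \<le> f \<and> q \<le> g \<longrightarrow> q \<le> j)"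
proof -
  obtain j where j: "j \<in> C" "(\<lambda>i. - f i) \<le> j" "(\<lambda>i. - g i) \<le> j"
    "\<And>q. q \<in> C \<Longrightarrow> (\<lambda>i. - f i) \<le> q \<Longrightarrow> (\<lambda>i. - g i) \<le> q \<Longrightarrow> j \<le> q"
    using ex_lub[OF neg_closed[OF assms(1)] neg_closed[OF assms(2)]] by blast
  have "q \<le> (\<lambda>i. - j i)" if "q \<in> C" "q \<le> f" "q \<le> g" for q
  proof -
    have "j \<le> (\<lambda>i. - q i)"
      using that by (intro j(4) neg_closed) (auto simp: le_fun_def)
    then show ?thesis by (auto simp: le_fun_def le_minus_iff)
  qed
  moreover have "(\<lambda>i. - j i) \<le> f" "(\<lambda>i. - j i) \<le> g"
    using j(2,3) by (auto simp: le_fun_def minus_le_iff)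
  ultimately show ?thesis
    using neg_closed[OF j(1)] by (intro bexI[of _ "\<lambda>i. - j i"]) auto
qed

lemma group: "group G"
proof (rule groupI)
  fix x assume "x \<in> carrier G"
  then show "\<exists>y\<in>carrier G. y \<otimes>\<^bsub>G\<^esub> x = \<one>\<^bsub>G\<^esub>"
    using neg_closed by (intro bexI[of _ "\<lambda>i. - x i"]) auto
qed (auto simp: add_closed zero_closed algebra_simps)

lemma lattice: "lattice (order_of G)"
  by unfold_locales
    (use ex_lub ex_glb in \<open>auto simp: is_lub_pointwise_iff is_glb_pointwise_iff Bex_def\<close>)

sublocale l_group G
proof (intro l_group.intro l_group_axioms.intro)
qed (auto simp: group lattice le_fun_def)

lemma inv_eq: "f \<in> C \<Longrightarrow> inv\<^bsub>G\<^esub> f = (\<lambda>i. - f i)"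
  by (rule inv_equality) (auto simp: neg_closed)

lemma archimedean: "archimedean G"
  unfolding archimedean_def
proof (intro ballI impI, elim conjE)
  fix a b assume a: "\<one>\<^bsub>G\<^esub> \<preceq>\<^bsub>G\<^esub> a" and n: "\<forall>n::nat. a [^]\<^bsub>G\<^esub> n \<preceq>\<^bsub>G\<^esub> b"
  have "a i = 0" for i
  proof (rule ccontr)
    assume "a i \<noteq> 0"
    then have "0 < a i" using a by (simp add: le_fun_def order_less_le)
    then obtain n where "b i < real n * a i" using ex_less_of_nat_mult by blast
    moreover have "real n * a i \<le> b i" using n by (simp add: pointwise_group_pow le_fun_def)
    ultimately show False by simp
  qed
  then show "a = \<one>\<^bsub>G\<^esub>" by auto
qed

text \<open>The operation \<open>join\<close> chooses some least upper bound, so its properties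
  follow once one exists.\<close>

lemma
  assumes "f \<in> C" "g \<in> C"
  shows join_closed: "lg_join G f g \<in> C"
    and join_upper1: "f \<le> lg_join G f g"
    and join_upper2: "g \<le> lg_join G f g"
    and join_least: "\<And>q. \<lbrakk>q \<in> C; f \<le> q; g \<le> q\<rbrakk> \<Longrightarrow> lg_join G f g \<le> q"
proof -
  have "\<exists>j. is_lub (order_of G) j {f, g}"
    using ex_lub[OF assms] by (simp add: is_lub_pointwise_iff assms Bex_def)
  then have "is_lub (order_of G) (lg_join G f g) {f, g}"
    unfolding join_def sup_def by (rule someI_ex)
  note * = this[unfolded is_lub_pointwise_iff[OF assms]]
  show "lg_join G f g \<in> C" "f \<le> lg_join G f g" "g \<le> lg_join G f g"
    "\<And>q. \<lbrakk>q \<in> C; f \<le> q; g \<le> q\<rbrakk> \<Longrightarrow> lg_join G f g \<le> q"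
    using * by blast+
qed

lemma
  assumes "f \<in> C" "g \<in> C"
  shows meet_closed: "lg_meet G f g \<in> C"
    and meet_lower1: "lg_meet G f g \<le> f"
    and meet_lower2: "lg_meet G f g \<le> g"
    and meet_greatest: "\<And>q. \<lbrakk>q \<in> C; q \<le> f; q \<le> g\<rbrakk> \<Longrightarrow> q \<le> lg_meet G f g"
proof -
  have "\<exists>j. is_glb (order_of G) j {f, g}"
    using ex_glb[OF assms] by (simp add: is_glb_pointwise_iff assms Bex_def)
  then have "is_glb (order_of G) (lg_meet G f g) {f, g}"
    unfolding meet_def inf_def by (rule someI_ex)
  note * = this[unfolded is_glb_pointwise_iff[OF assms]]
  show "lg_meet G f g \<in> C" "lg_meet G f g \<le> f" "lg_meet G f g \<le> g"
    "\<And>q. \<lbrakk>q \<in> C; q \<le> f; q \<le> g\<rbrakk> \<Longrightarrow> q \<le> lg_meet G f g"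
    using * by blast+
qed

lemma
  assumes "f \<in> C"
  shows abs_closed: "lg_abs G f \<in> C"
    and le_abs: "f \<le> lg_abs G f"
    and neg_le_abs: "(\<lambda>i. - f i) \<le> lg_abs G f"
  using assms neg_closed[OF assms] unfolding lg_abs_def
  by (auto simp: inv_eq intro: join_closed join_upper1 join_upper2)

lemma abs_nonneg: "f \<in> C \<Longrightarrow> (\<lambda>i. 0) \<le> lg_abs G f"
  using le_abs[of f] neg_le_abs[of f] unfolding le_fun_def
  by (metis abs_ge_zero abs_le_iff order_trans)

lemma abs_of_nonneg:
  assumes "f \<in> C" "(\<lambda>i. 0) \<le> f"
  shows "lg_abs G f = f"
proof (rule antisym)
  have "(\<lambda>i. - f i) \<le> f" 
    using assms(2) by (auto simp: le_fun_def intro: order_trans[of _ 0])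
  then show "lg_abs G f \<le> f" unfolding lg_abs_def inv_eq[OF assms(1)]
    by (intro join_least) (auto simp: assms neg_closed)
qed (rule le_abs[OF assms(1)])

lemma meet_eq_zero_iff:
  assumes "f \<in> C" "g \<in> C" "(\<lambda>i. 0) \<le> f" "(\<lambda>i. 0) \<le> g"
  shows "lg_meet G f g = (\<lambda>i. 0) \<longleftrightarrow> disjoint_in C f g"
proof
  assume m: "lg_meet G f g = (\<lambda>i. 0)"
  show "disjoint_in C f g" unfolding disjoint_in_def
    using meet_greatest[OF assms(1,2)] m by (auto intro!: antisym)
next
  assume "disjoint_in C f g"
  then show "lg_meet G f g = (\<lambda>i. 0)" unfolding disjoint_in_def
    using meet_closed[OF assms(1,2)] meet_lower1[OF assms(1,2)] meet_lower2[OF assms(1,2)]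
      meet_greatest[OF assms(1,2) zero_closed] assms(3,4) by blast
qed

section \<open>Convex l-subgroups and criteria for (M) and (Y)\<close>

lemma convex_abs_mem:
  assumes "convex_l_subgroup G H" "f \<in> H"
  shows "lg_abs G f \<in> H"
  using assms subgroup.m_inv_closed[of H G f] unfolding convex_l_subgroup_def lg_abs_def by blast

lemma convex_mem:
  assumes "convex_l_subgroup G H" "f \<in> H" "g \<in> H" "q \<in> C" "f \<le> q" "q \<le> g"
  shows "q \<in> H"
  using assms unfolding convex_l_subgroup_def pointwise_group_simps by blast

lemma convex_subgroup: "convex_l_subgroup G H \<Longrightarrow> subgroup H G"
  by (simp add: convex_l_subgroup_def)

lemma convex_subset: "convex_l_subgroup G H \<Longrightarrow> H \<subseteq> C"
  using subgroup.subset[OF convex_subgroup] by simp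

lemma convex_zero: "convex_l_subgroup G H \<Longrightarrow> (\<lambda>i. 0) \<in> H"
  using subgroup.one_closed[OF convex_subgroup] by simp

lemma convex_add: "convex_l_subgroup G H \<Longrightarrow> f \<in> H \<Longrightarrow> g \<in> H \<Longrightarrow> (\<lambda>i. f i + g i) \<in> H"
  using subgroup.m_closed[OF convex_subgroup, of H f g] by simp

lemma convex_neg: "convex_l_subgroup G H \<Longrightarrow> f \<in> H \<Longrightarrow> (\<lambda>i. - f i) \<in> H"
  using subgroup.m_inv_closed[OF convex_subgroup, of H f] convex_subset[of H] inv_eq[of f] by auto

lemma convex_scale: "convex_l_subgroup G H \<Longrightarrow> f \<in> H \<Longrightarrow> (\<lambda>i. real n * f i) \<in> H"
proof (induction n)
  case (Suc n)
  then show ?case using convex_add[of H f "\<lambda>i. real n * f i"] by (simp add: algebra_simps)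
qed (simp add: convex_zero)

text \<open>For nonnegative elements the inner premise expresses that \<open>d\<close> lies in the
  double polar of \<open>a\<close>. A convex l-subgroup containing \<open>a\<close> contains every
  multiple of its absolute value, so a bound of \<open>d\<close> by such a multiple puts
  \<open>d\<close> into it.\<close>

lemma property_M_criterion:
  assumes dom: "\<And>a d. \<lbrakk>a \<in> C; d \<in> C; (\<lambda>i. 0) \<le> a; (\<lambda>i. 0) \<le> d;
      \<And>p. \<lbrakk>p \<in> C; (\<lambda>i. 0) \<le> p; disjoint_in C p a\<rbrakk> \<Longrightarrow> disjoint_in C p d\<rbrakk>
      \<Longrightarrow> \<exists>n::nat. d \<le> (\<lambda>i. real n * a i)"
  shows "property_M G"
  unfolding property_M_def
proof (intro allI impI ballI subsetI)
  fix H a d assume H: "convex_l_subgroup G H" and a: "a \<in> H" and d: "d \<in> perp G (perp G {a})"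
  have aC: "a \<in> C" using a convex_subset[OF H] by auto
  have dC: "d \<in> C" using d by (auto simp: perp_def)
  have "disjoint_in C p (lg_abs G d)"
    if p: "p \<in> C" "(\<lambda>i. 0) \<le> p" "disjoint_in C p (lg_abs G a)" for p
  proof -
    have "p \<in> perp G {a}"
      using p by (simp add: perp_def abs_of_nonneg meet_eq_zero_iff abs_closed abs_nonneg aC)
    then have "lg_meet G (lg_abs G d) p = (\<lambda>i. 0)"
      using d p abs_of_nonneg[OF p(1,2)] by (auto simp: perp_def)
    then show ?thesis
      using p by (simp add: meet_eq_zero_iff abs_closed abs_nonneg dC disjoint_in_commute)
  qed
  then obtain n :: nat where n: "lg_abs G d \<le> (\<lambda>i. real n * lg_abs G a i)"
    using dom[of "lg_abs G a" "lg_abs G d"] by (auto simp: abs_closed abs_nonneg aC dC)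
  have m: "(\<lambda>i. real n * lg_abs G a i) \<in> H"
    using H a by (intro convex_scale convex_abs_mem)
  show "d \<in> H"
  proof (rule convex_mem[OF H convex_neg[OF H m] m dC])
    show "d \<le> (\<lambda>i. real n * lg_abs G a i)" using le_abs[OF dC] n by (rule order_trans)
    have "(\<lambda>i. - d i) \<le> (\<lambda>i. real n * lg_abs G a i)"
      using neg_le_abs[OF dC] n by (rule order_trans)
    then show "(\<lambda>i. - (real n * lg_abs G a i)) \<le> d" by (auto simp: le_fun_def minus_le_iff)
  qed
qed

text \<open>The principal subgroup of zero is trivial, whereas any intersection of maximal convex
  l-subgroups would contain the nonzero element \<open>c\<close>.\<close>

lemma not_property_Y_criterion:
  assumes "c \<in> C" "(\<lambda>i. 0) \<le> c" "c \<noteq> (\<lambda>i. 0)"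
    and "\<And>M. maximal_convex_l_subgroup G M \<Longrightarrow> c \<in> M"
  shows "\<not> property_Y G"
proof
  assume "property_Y G"
  then obtain \<M> where "\<forall>M\<in>\<M>. maximal_convex_l_subgroup G M"
    "principal G (\<lambda>i. 0) = carrier G \<inter> \<Inter>\<M>"
    using zero_closed unfolding property_Y_def by auto
  then have "c \<in> principal G (\<lambda>i. 0)" using assms by auto
  then have "c \<le> (\<lambda>i. 0)"
    using abs_of_nonneg[OF assms(1,2)] abs_of_nonneg[OF zero_closed]
    by (auto simp: principal_def pointwise_group_pow)
  then show False using assms(2,3) by (auto dest: antisym)
qed

text \<open>The set \<open>K\<close> in the proof is the convex l-subgroup generated by
  \<open>M\<close> and \<open>c\<close>. It is strictly larger than \<open>M\<close>, hence
  everything by maximality, so \<open>b\<close> satisfies the bound that defines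
  \<open>K\<close>.\<close>

lemma maximal_dominates:
  assumes M: "maximal_convex_l_subgroup G M" and c: "c \<in> C" "(\<lambda>i. 0) \<le> c" "c \<notin> M"
    and b: "b \<in> C"
  obtains m and n :: nat where "m \<in> M" "(\<lambda>i. 0) \<le> m" "b \<le> (\<lambda>i. m i + real n * c i)"
proof -
  define K where "K = {f \<in> C. \<exists>m\<in>M. \<exists>n::nat. (\<lambda>i. 0) \<le> m \<and>
      f \<le> (\<lambda>i. m i + real n * c i) \<and> (\<lambda>i. - f i) \<le> (\<lambda>i. m i + real n * c i)}"
  have M': "convex_l_subgroup G M"
    using M by (auto simp: maximal_convex_l_subgroup_def)
  have KI: "f \<in> K" if "f \<in> C" "m \<in> M" "\<And>i. 0 \<le> m i" "\<And>i. f i \<le> m i + real n * c i"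
    "\<And>i. - f i \<le> m i + real n * c i" for f m n
    using that unfolding K_def le_fun_def by blast
  have KE: thesis if "f \<in> K" "\<And>m n. \<lbrakk>f \<in> C; m \<in> M; \<And>i. 0 \<le> m i; \<And>i. f i \<le> m i + real n * c i;
    \<And>i. - f i \<le> m i + real n * c i\<rbrakk> \<Longrightarrow> thesis" for f thesis
    using that unfolding K_def le_fun_def by blast
  \<comment> \<open>One estimate serves inverses, sums, joins, meets and convexity: adding the
    bounds of \<open>f\<close> and \<open>g\<close> gives a function above all those listed, and
    therefore above \<open>h\<close> and its negative.\<close>
  have between: "h \<in> K" if fg: "f \<in> K" "g \<in> K" and h: "h \<in> C"
    and hb: "\<And>z. \<lbrakk>z \<in> C; f \<le> z; g \<le> z; (\<lambda>i. - f i) \<le> z; (\<lambda>i. - g i) \<le> z;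
      (\<lambda>i. f i + g i) \<le> z; (\<lambda>i. - f i - g i) \<le> z\<rbrakk> \<Longrightarrow> h \<le> z \<and> (\<lambda>i. - h i) \<le> z" for f g h
  proof -
    obtain m n where f: "f \<in> C" "m \<in> M" "\<And>i. 0 \<le> m i" "\<And>i. f i \<le> m i + real n * c i"
      "\<And>i. - f i \<le> m i + real n * c i" using KE[OF fg(1)] by metis
    obtain m' n' where g: "g \<in> C" "m' \<in> M" "\<And>i. 0 \<le> m' i" "\<And>i. g i \<le> m' i + real n' * c i"
      "\<And>i. - g i \<le> m' i + real n' * c i" using KE[OF fg(2)] by metis
    let ?z = "\<lambda>i. (m i + m' i) + real (n + n') * c i"
    have mm: "(\<lambda>i. m i + m' i) \<in> M" by (rule convex_add[OF M' f(2) g(2)])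
    have zC: "?z \<in> C" using f(2) g(2) convex_subset[OF M'] by (intro add_closed scale_closed c(1)) auto
    have c0: "0 \<le> real k * c i" for k i using c(2) by (simp add: le_fun_def)
    have "h \<le> ?z \<and> (\<lambda>i. - h i) \<le> ?z"
    proof (rule hb[OF zC], unfold le_fun_def, safe)
      fix i
      note * = f(3)[of i] f(4)[of i] f(5)[of i] g(3)[of i] g(4)[of i] g(5)[of i] c0[of n i] c0[of n' i]
      have z: "?z i = (m i + real n * c i) + (m' i + real n' * c i)" by (simp add: algebra_simps)
      show "f i \<le> ?z i" "g i \<le> ?z i" "- f i \<le> ?z i" "- g i \<le> ?z i" "f i + g i \<le> ?z i"
        "- f i - g i \<le> ?z i" unfolding z using * by linarith+
    qed
    then show ?thesis using mm f(3) g(3)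
      by (intro KI[OF h mm, of "n + n'"]) (auto simp: le_fun_def)
  qed
  have K0: "(\<lambda>i. 0) \<in> K"
    by (rule KI[OF zero_closed convex_zero[OF M'], of 0]) auto
  have KC: "K \<subseteq> C" by (auto simp: K_def)
  have "subgroup K G"
  proof (rule subgroupI)
    fix f assume f: "f \<in> K"
    then show "inv\<^bsub>G\<^esub> f \<in> K" using KC inv_eq[of f] neg_closed[of f]
      by (intro between[OF f f]) auto
  next
    fix f g assume fg: "f \<in> K" "g \<in> K"
    then show "f \<otimes>\<^bsub>G\<^esub> g \<in> K" using KC add_closed[of f g]
      by (intro between[OF fg]) auto
  qed (use K0 KC in auto)
  moreover have "lg_join G f g \<in> K \<and> lg_meet G f g \<in> K" if fg: "f \<in> K" "g \<in> K" for f g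
  proof -
    have C: "f \<in> C" "g \<in> C" using fg KC by auto
    have "lg_join G f g \<in> K"
    proof (rule between[OF fg join_closed[OF C]], intro conjI join_least[OF C])
      fix z assume "(\<lambda>i. - f i) \<le> z"
      then show "(\<lambda>i. - lg_join G f g i) \<le> z"
        using join_upper1[OF C] unfolding le_fun_def by (metis neg_le_iff_le order_trans)
    qed
    moreover have "lg_meet G f g \<in> K"
    proof (rule between[OF fg meet_closed[OF C]], intro conjI)
      fix z assume z: "z \<in> C" "f \<le> z" "(\<lambda>i. - f i) \<le> z" "(\<lambda>i. - g i) \<le> z"
      show "lg_meet G f g \<le> z" using meet_lower1[OF C] z(2) by (rule order_trans)
      have "(\<lambda>i. - z i) \<le> lg_meet G f g"
        using z by (intro meet_greatest[OF C] neg_closed) (auto simp: le_fun_def minus_le_iff)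
      then show "(\<lambda>i. - lg_meet G f g i) \<le> z" by (auto simp: le_fun_def minus_le_iff)
    qed
    ultimately show ?thesis ..
  qed
  moreover have "q \<in> K" if fg: "f \<in> K" "g \<in> K" and q: "q \<in> C" "f \<le> q" "q \<le> g" for f g q
  proof (rule between[OF fg q(1)], intro conjI)
    fix z assume z: "g \<le> z" "(\<lambda>i. - f i) \<le> z"
    show "q \<le> z" using q(3) z(1) by (rule order_trans)
    show "(\<lambda>i. - q i) \<le> z" using q(2) z(2) unfolding le_fun_def by (metis neg_le_iff_le order_trans)
  qed
  ultimately have K: "convex_l_subgroup G K"
    unfolding convex_l_subgroup_def pointwise_group_simps by blast
  have "M \<subseteq> K"
  proof
    fix f assume f: "f \<in> M"
    then have fC: "f \<in> C" using convex_subset[OF M'] by auto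
    show "f \<in> K" using le_abs[OF fC] neg_le_abs[OF fC] abs_nonneg[OF fC]
      by (intro KI[OF fC convex_abs_mem[OF M' f], of 0]) (auto simp: le_fun_def)
  qed
  moreover have "c \<in> K"
  proof (rule KI[OF c(1) convex_zero[OF M'], of 1])
    fix i show "- c i \<le> 0 + real 1 * c i" 
      using c(2) by (auto simp: le_fun_def intro: order_trans[of _ 0])
  qed auto
  ultimately have "K = C" using M K c(3)
    unfolding maximal_convex_l_subgroup_def pointwise_group_simps by blast
  then have "b \<in> K" using b by simp
  then show thesis using that by (auto simp: K_def)
qed

end

section \<open>Harmonic functions on the binary tree\<close>

definition harmonic :: "(bool list \<Rightarrow> real) \<Rightarrow> bool" where
  "harmonic F \<longleftrightarrow> (\<forall>s. F (s @ [False]) + F (s @ [True]) = 2 * F s)"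

abbreviation branch :: "(nat \<Rightarrow> bool) \<Rightarrow> nat \<Rightarrow> bool list" where
  "branch y n \<equiv> map y [0..<n]"

lemma branch_Suc: "branch y (Suc n) = y 0 # branch (y \<circ> Suc) n"
  by (simp add: upt_conv_Cons map_Suc_upt[symmetric] del: upt_Suc)

lemma branch_add: "branch y (n + k) = branch y n @ branch (\<lambda>i. y (n + i)) k"
  by (induction k) auto

text \<open>Compactness of the Cantor space, in the form of bar induction.\<close>

lemma bar_induct:
  assumes bar: "\<And>y. \<exists>n. P (branch y n)"
    and step: "\<And>s. P (s @ [False]) \<Longrightarrow> P (s @ [True]) \<Longrightarrow> P s"
  shows "P []"
proof (rule ccontr)
  assume "\<not> P []"
  \<comment> \<open>A node violating \<open>P\<close> has a child violating \<open>P\<close>;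
    choosing such a child again and again traces a branch that never meets the bar.\<close>
  define next_bit where "next_bit s = (SOME b. \<not> P (s @ [b]))" for s
  define path where "path = rec_nat [] (\<lambda>_ s. s @ [next_bit s])"
  have path: "path 0 = []" "path (Suc n) = path n @ [next_bit (path n)]" for n
    by (simp_all add: path_def)
  have nP: "\<not> P (path n)" for n
  proof (induction n)
    case (Suc n)
    then have "\<exists>b. \<not> P (path n @ [b])" using step by blast
    then show ?case unfolding path next_bit_def by (rule someI_ex)
  qed (simp add: path \<open>\<not> P []\<close>)
  have "path n = branch (\<lambda>i. next_bit (path i)) n" for n
    by (induction n) (auto simp: path)
  then show False using nP bar by metis
qed

lemma harmonic_shift: "harmonic F \<Longrightarrow> harmonic (\<lambda>t. F (s @ t))"
  unfolding harmonic_def by (metis append_assoc)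

text \<open>An inequality at both children passes to the parent by averaging, so bar induction
  reduces the comparison to a neighbourhood of each point of the Cantor space.\<close>

lemma harmonic_le:
  assumes "harmonic F" "harmonic G"
    and loc: "\<And>y. \<exists>n. \<forall>t. F (branch y n @ t) \<le> G (branch y n @ t)"
  shows "F t \<le> G t"
proof -
  have "\<forall>t. F ([] @ t) \<le> G ([] @ t)"
  proof (rule bar_induct[of "\<lambda>s. \<forall>t. F (s @ t) \<le> G (s @ t)"])
    fix s
    assume l: "\<forall>t. F ((s @ [False]) @ t) \<le> G ((s @ [False]) @ t)"
      and r: "\<forall>t. F ((s @ [True]) @ t) \<le> G ((s @ [True]) @ t)"
    show "\<forall>t. F (s @ t) \<le> G (s @ t)"
    proof
      fix t
      show "F (s @ t) \<le> G (s @ t)"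
      proof (cases t)
        case Nil
        have "F (s @ [False]) \<le> G (s @ [False])" "F (s @ [True]) \<le> G (s @ [True])"
          using l r by (metis append_Nil2)+
        then show ?thesis using assms(1,2) Nil unfolding harmonic_def
          by (smt (verit) append_Nil2)
      next
        case (Cons b u)
        then show ?thesis using l r by (cases b) auto
      qed
    qed
  qed (rule loc)
  then show ?thesis by simp
qed

text \<open>\<open>cone s t\<close> is the average over the cone of \<open>t\<close> of the indicator function of the cone of \<open>s\<close>.\<close>

fun cone :: "bool list \<Rightarrow> bool list \<Rightarrow> real" where
  "cone [] t = 1"
| "cone (b # s) [] = cone s [] / 2"
| "cone (b # s) (b' # t) = (if b = b' then cone s t else 0)"

text \<open>\<open>pole y t\<close> is the average over the cone of \<open>t\<close> of the function sending a point \<open>x\<close> of the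
  Cantor space to the number of initial bits on which \<open>x\<close> and \<open>y\<close> agree, which is infinite at \<open>y\<close>;
  \<open>pole_atom y\<close> is the indicator function of the prefixes of \<open>y\<close>.\<close>

fun pole :: "(nat \<Rightarrow> bool) \<Rightarrow> bool list \<Rightarrow> real" where
  "pole y [] = 1"
| "pole y (b # t) = (if b = y 0 then 1 + pole (y \<circ> Suc) t else 0)"

fun pole_atom :: "(nat \<Rightarrow> bool) \<Rightarrow> bool list \<Rightarrow> real" where
  "pole_atom y [] = 1"
| "pole_atom y (b # t) = (if b = y 0 then pole_atom (y \<circ> Suc) t else 0)"

lemma cone_singletons: "cone (s @ [False]) t + cone (s @ [True]) t = cone s t"
proof (induction s t rule: cone.induct)
  case (1 t)
  then show ?case by (cases t) auto
qed auto

lemma harmonic_cone: "harmonic (cone s)"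
proof -
  have "cone s (t @ [False]) + cone s (t @ [True]) = 2 * cone s t" for t
  proof (induction s t rule: cone.induct)
    case (2 b s)
    then show ?case by (cases b; cases s) auto
  qed auto
  then show ?thesis by (simp add: harmonic_def)
qed

lemma harmonic_pole: "harmonic (pole y)"
proof -
  have "pole y (t @ [False]) + pole y (t @ [True]) = 2 * pole y t" for t
    by (induction y t rule: pole.induct) (auto simp: comp_def)
  then show ?thesis by (simp add: harmonic_def)
qed

section \<open>Cones and poles on subtrees\<close>

lemma cone_nonneg: "0 \<le> cone s t" and cone_le_one: "cone s t \<le> 1"
  by (induction s t rule: cone.induct) auto

lemma cone_above: "cone s (s @ t) = 1"
  by (induction s) auto

lemma cone_incomparable: "length s = length s' \<Longrightarrow> s \<noteq> s' \<Longrightarrow> cone s (s' @ t) = 0"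
  by (induction s s' rule: list_induct2) auto

lemma pole_nonneg: "0 \<le> pole y t"
  by (induction y t rule: pole.induct) (auto simp: comp_def)

lemma pole_atom_nonneg: "0 \<le> pole_atom y t"
  by (induction y t rule: pole_atom.induct) (auto simp: comp_def)

text \<open>All points of the cone of \<open>branch y n\<close> share the first \<open>n\<close>
  bits of \<open>y\<close>, and further agreement is counted on the remaining bits. In particular
  the pole is at least \<open>n\<close> there.\<close>

lemma pole_above: "pole y (branch y n @ t) = real n + pole (\<lambda>i. y (n + i)) t"
proof (induction n arbitrary: y)
  case (Suc n)
  then show ?case by (simp add: branch_Suc comp_def del: upt_Suc)
qed auto

lemma pole_atom_above: "pole_atom y (branch y n @ t) = pole_atom (\<lambda>i. y (n + i)) t"
proof (induction n arbitrary: y)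
  case (Suc n)
  then show ?case by (simp add: branch_Suc comp_def del: upt_Suc)
qed auto

lemma pole_off: "y \<noteq> z \<Longrightarrow> \<exists>n c. \<forall>t. pole y (branch z n @ t) = c \<and> pole_atom y (branch z n @ t) = 0"
proof -
  assume "y \<noteq> z"
  then have ex: "\<exists>n. y n \<noteq> z n" by auto
  \<comment> \<open>Agreement stops at the first differing bit: past it the count is exactly
    \<open>n\<close> and no node is a prefix of \<open>y\<close>.\<close>
  define n where "n = (LEAST n. y n \<noteq> z n)"
  have n: "y n \<noteq> z n" "\<And>k. k < n \<Longrightarrow> y k = z k"
    unfolding n_def using LeastI_ex[OF ex] not_less_Least by blast+
  have b: "branch z (Suc n) = branch y n @ [z n]" using n(2) by simp
  have "pole y (branch z (Suc n) @ t) = real n \<and> pole_atom y (branch z (Suc n) @ t) = 0" for t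
    unfolding b append_assoc pole_above pole_atom_above using n(1) by auto
  then show ?thesis by blast
qed

section \<open>The group\<close>

text \<open>Both components share the coefficient \<open>r\<close>, so the values at the nodes of a
  branch record the strength of the pole at its end. Where \<open>r = 0\<close>, near
  \<open>y\<close> the function is constant and the node values vanish; by compactness this is the
  case at all but finitely many points.\<close>

definition locally_simple :: "(bool list \<Rightarrow> real) \<Rightarrow> (bool list \<Rightarrow> real) \<Rightarrow> bool" where
  "locally_simple F h \<longleftrightarrow> (\<forall>y. \<exists>n c r. \<forall>t. F (branch y n @ t) = c + r * pole y (branch y n @ t) \<and>
    h (branch y n @ t) = r * pole_atom y (branch y n @ t))"

text \<open>The coefficients do not change at deeper nodes of the branch, so two pairs can be
  compared at a common depth.\<close>

lemma locally_simpleE: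
  assumes "locally_simple F h"
  obtains n c r where
    "\<And>k t. n \<le> k \<Longrightarrow> F (branch y k @ t) = c + r * pole y (branch y k @ t)"
    "\<And>k t. n \<le> k \<Longrightarrow> h (branch y k @ t) = r * pole_atom y (branch y k @ t)"
proof -
  obtain n c r where *: "\<And>t. F (branch y n @ t) = c + r * pole y (branch y n @ t)"
    "\<And>t. h (branch y n @ t) = r * pole_atom y (branch y n @ t)"
    using assms unfolding locally_simple_def by metis
  show thesis
  proof (rule that)
    fix k t assume "n \<le> k"
    then have k: "branch y k @ t = branch y n @ (branch (\<lambda>i. y (n + i)) (k - n) @ t)"
      using branch_add[of y n "k - n"] by simp
    show "F (branch y k @ t) = c + r * pole y (branch y k @ t)"
      "h (branch y k @ t) = r * pole_atom y (branch y k @ t)"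
      unfolding k * by simp_all
  qed
qed

lemma locally_simple_lincomb:
  assumes "locally_simple F h" "locally_simple F' h'"
  shows "locally_simple (\<lambda>t. u * F t + v * F' t) (\<lambda>t. u * h t + v * h' t)"
  unfolding locally_simple_def
proof
  fix y
  obtain n c r where 1:
    "\<And>k t. n \<le> k \<Longrightarrow> F (branch y k @ t) = c + r * pole y (branch y k @ t)"
    "\<And>k t. n \<le> k \<Longrightarrow> h (branch y k @ t) = r * pole_atom y (branch y k @ t)"
    using locally_simpleE[OF assms(1), of y] by metis
  obtain n' c' r' where 2:
    "\<And>k t. n' \<le> k \<Longrightarrow> F' (branch y k @ t) = c' + r' * pole y (branch y k @ t)"
    "\<And>k t. n' \<le> k \<Longrightarrow> h' (branch y k @ t) = r' * pole_atom y (branch y k @ t)"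
    using locally_simpleE[OF assms(2), of y] by metis
  show "\<exists>n c r. \<forall>t. u * F (branch y n @ t) + v * F' (branch y n @ t) = c + r * pole y (branch y n @ t) \<and>
    u * h (branch y n @ t) + v * h' (branch y n @ t) = r * pole_atom y (branch y n @ t)"
    by (rule exI[of _ "max n n'"], rule exI[of _ "u * c + v * c'"], rule exI[of _ "u * r + v * r'"])
      (simp add: 1 2 algebra_simps)
qed

text \<open>The point \<open>y\<close> seen from \<open>s\<close> is the point \<open>z\<close>,
  which is \<open>s\<close> followed by \<open>y\<close>. Moving the root to \<open>s\<close> lowers
  the pole by the length of \<open>s\<close>, and the constant term absorbs the difference.\<close>

lemma locally_simple_shift:
  assumes "locally_simple F h"
  shows "locally_simple (\<lambda>t. F (s @ t)) (\<lambda>t. h (s @ t))"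
  unfolding locally_simple_def
proof
  fix y
  define m where "m = length s"
  define z where "z i = (if i < m then s ! i else y (i - m))" for i
  have s: "branch z m = s" by (rule nth_equalityI) (auto simp: m_def z_def)
  have zy: "(\<lambda>i. z (m + i)) = y" by (auto simp: z_def)
  obtain n c r where *:
    "\<And>k t. n \<le> k \<Longrightarrow> F (branch z k @ t) = c + r * pole z (branch z k @ t)"
    "\<And>k t. n \<le> k \<Longrightarrow> h (branch z k @ t) = r * pole_atom z (branch z k @ t)"
    using locally_simpleE[OF assms, of z] by metis
  have b: "s @ branch y n @ t = branch z (m + n) @ t" for t
    unfolding branch_add s zy by simp
  have p: "pole z (branch z (m + n) @ t) = real m + pole y (branch y n @ t)"
    "pole_atom z (branch z (m + n) @ t) = pole_atom y (branch y n @ t)" for t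
    unfolding branch_add append_assoc pole_above[of z m] pole_atom_above[of z m] zy by simp_all
  have "F (s @ branch y n @ t) = (c + r * real m) + r * pole y (branch y n @ t) \<and>
    h (s @ branch y n @ t) = r * pole_atom y (branch y n @ t)" for t
    unfolding b *[OF le_add2] p by (simp add: algebra_simps)
  then show "\<exists>n c r. \<forall>t. F (s @ branch y n @ t) = c + r * pole y (branch y n @ t) \<and>
    h (s @ branch y n @ t) = r * pole_atom y (branch y n @ t)" by blast
qed

lemma locally_simple_glue:
  assumes "\<And>b. locally_simple (\<lambda>t. F (b # t)) (\<lambda>t. h (b # t))"
  shows "locally_simple F h"
  unfolding locally_simple_def
proof
  fix y
  obtain n c r where *: "\<And>t. F (y 0 # branch (y \<circ> Suc) n @ t) = c + r * pole (y \<circ> Suc) (branch (y \<circ> Suc) n @ t)"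
    "\<And>t. h (y 0 # branch (y \<circ> Suc) n @ t) = r * pole_atom (y \<circ> Suc) (branch (y \<circ> Suc) n @ t)"
    using assms[of "y 0"] unfolding locally_simple_def by metis
  \<comment> \<open>Restoring the first bit raises the pole by one, which the constant
    \<open>c - r\<close> compensates.\<close>
  show "\<exists>n c r. \<forall>t. F (branch y n @ t) = c + r * pole y (branch y n @ t) \<and>
    h (branch y n @ t) = r * pole_atom y (branch y n @ t)"
    by (rule exI[of _ "Suc n"], rule exI[of _ "c - r"], rule exI[of _ r])
      (use * in \<open>simp add: branch_Suc algebra_simps del: upt_Suc\<close>)
qed

lemma locally_simple_zero: "locally_simple (\<lambda>t. 0) (\<lambda>t. 0)"
  unfolding locally_simple_def by (intro allI exI[of _ 0]) auto

lemma locally_simple_cone: "locally_simple (cone s) (\<lambda>t. 0)"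
  unfolding locally_simple_def
proof
  fix y
  have "\<exists>c. \<forall>t. cone s (branch y (length s) @ t) = c"
    using cone_above[of s] cone_incomparable[of s "branch y (length s)"]
    by (cases "s = branch y (length s)") auto
  then show "\<exists>n c r. \<forall>t. cone s (branch y n @ t) = c + r * pole y (branch y n @ t) \<and>
    0 = r * pole_atom y (branch y n @ t)"
    by (metis add.right_neutral mult_zero_left)
qed

lemma locally_simple_atom: "locally_simple (\<lambda>t. 0) (\<lambda>t. if t = s then 1 else 0)"
  unfolding locally_simple_def
proof
  fix y
  have "branch y (Suc (length s)) @ t \<noteq> s" for t
    by (metis length_append length_map length_upt diff_zero not_add_less1 lessI)
  then show "\<exists>n c r. \<forall>t. 0 = c + r * pole y (branch y n @ t) \<and>
    (if branch y n @ t = s then 1 else 0) = r * pole_atom y (branch y n @ t)"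
    by (intro exI[of _ "Suc (length s)"] exI[of _ 0]) simp
qed

lemma locally_simple_pole: "locally_simple (pole y) (pole_atom y)"
  unfolding locally_simple_def
proof
  fix z
  show "\<exists>n c r. \<forall>t. pole y (branch z n @ t) = c + r * pole z (branch z n @ t) \<and>
      pole_atom y (branch z n @ t) = r * pole_atom z (branch z n @ t)"
  proof (cases "y = z")
    case True
    then show ?thesis by (intro exI[of _ 0] exI[of _ 1]) auto
  next
    case False
    then show ?thesis using pole_off[OF False] by (metis add.right_neutral mult_zero_left)
  qed
qed

section \<open>Local signs and positive parts\<close>

lemma locally_simple_sign:
  assumes "locally_simple F h"
  shows "\<exists>n. (\<forall>t. 0 \<le> F (branch y n @ t) \<and> 0 \<le> h (branch y n @ t)) \<or>
    (\<forall>t. F (branch y n @ t) \<le> 0 \<and> h (branch y n @ t) \<le> 0)"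
proof -
  obtain n c r where *:
    "\<And>k t. n \<le> k \<Longrightarrow> F (branch y k @ t) = c + r * pole y (branch y k @ t)"
    "\<And>k t. n \<le> k \<Longrightarrow> h (branch y k @ t) = r * pole_atom y (branch y k @ t)"
    using locally_simpleE[OF assms, of y] by metis
  \<comment> \<open>From depth \<open>j\<close> on the pole is at least \<open>j\<close>. If
    \<open>r\<close> is nonzero, its term thus outweighs \<open>c\<close>, and \<open>F\<close> and
    \<open>h\<close> both take the sign of \<open>r\<close>; if \<open>r = 0\<close>, then
    \<open>F\<close> is the constant \<open>c\<close> and \<open>h\<close> vanishes.\<close>
  obtain j :: nat where j: "\<bar>c\<bar> \<le> real j * \<bar>r\<bar> \<or> r = 0"
    using ex_less_of_nat_mult[of "\<bar>r\<bar>" "\<bar>c\<bar>"] by (metis less_imp_le zero_less_abs_iff)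
  define k where "k = max n j"
  have k: "n \<le> k" "j \<le> k" by (auto simp: k_def)
  have m: "real j \<le> pole y (branch y k @ t)" for t
    using pole_above[of y k t] pole_nonneg[of "\<lambda>i. y (k + i)" t] k(2) by linarith
  have m': "real j * \<bar>r\<bar> \<le> \<bar>r\<bar> * pole y (branch y k @ t)" for t
    using mult_right_mono[OF m[of t], of "\<bar>r\<bar>"] by (simp add: mult.commute)
  consider "r = 0" "0 \<le> c" | "r = 0" "c \<le> 0" | "0 < r" | "r < 0" by linarith
  then show ?thesis
  proof cases
    case 3
    then have "0 \<le> c + r * pole y (branch y k @ t)" for t
      using m'[of t, unfolded abs_of_pos[OF 3]] j[unfolded abs_of_pos[OF 3]] by linarith
    then show ?thesis using 3 *[OF k(1)] pole_atom_nonneg by (intro exI[of _ k]) auto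
  next
    case 4
    then have "c + r * pole y (branch y k @ t) \<le> 0" for t
      using m'[of t, unfolded abs_of_neg[OF 4]] j[unfolded abs_of_neg[OF 4]] by linarith
    then show ?thesis using 4 *[OF k(1)] pole_atom_nonneg
      by (intro exI[of _ k]) (auto intro: mult_nonpos_nonneg)
  qed (use * k in \<open>auto intro!: exI[of _ k]\<close>)
qed

text \<open>Near each point \<open>F\<close> and \<open>h\<close> have a common sign, so there the
  positive part is the pair itself or zero. Bar induction glues these pieces to the least harmonic
  majorant of \<open>F\<close> and zero, while the node component is simply the pointwise
  maximum.\<close>

lemma locally_simple_positive_part:
  assumes F: "harmonic F" and Fh: "locally_simple F h"
  obtains A where "harmonic A" "locally_simple A (\<lambda>t. max 0 (h t))" "\<And>t. 0 \<le> A t" "\<And>t. F t \<le> A t"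
    "\<And>B. \<lbrakk>harmonic B; \<And>t. 0 \<le> B t; \<And>t. F t \<le> B t\<rbrakk> \<Longrightarrow> (\<And>t. A t \<le> B t)"
proof -
  define P where "P s A \<longleftrightarrow> harmonic A \<and> locally_simple A (\<lambda>t. max 0 (h (s @ t))) \<and>
    (\<forall>t. 0 \<le> A t \<and> F (s @ t) \<le> A t) \<and>
    (\<forall>B. harmonic B \<longrightarrow> (\<forall>t. 0 \<le> B t \<and> F (s @ t) \<le> B t) \<longrightarrow> (\<forall>t. A t \<le> B t))" for s A
  have "\<exists>A. P [] A"
  proof (rule bar_induct[of "\<lambda>s. \<exists>A. P s A"])
    fix y
    obtain n where "(\<forall>t. 0 \<le> F (branch y n @ t) \<and> 0 \<le> h (branch y n @ t)) \<or>
      (\<forall>t. F (branch y n @ t) \<le> 0 \<and> h (branch y n @ t) \<le> 0)"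
      using locally_simple_sign[OF Fh] by blast
    then consider "\<forall>t. 0 \<le> F (branch y n @ t) \<and> 0 \<le> h (branch y n @ t)" |
      "\<forall>t. F (branch y n @ t) \<le> 0 \<and> h (branch y n @ t) \<le> 0" by blast
    then show "\<exists>n A. P (branch y n) A"
    proof cases
      case 1
      then have "P (branch y n) (\<lambda>t. F (branch y n @ t))"
        using harmonic_shift[OF F] locally_simple_shift[OF Fh, of "branch y n"] by (simp add: P_def)
      then show ?thesis by blast
    next
      case 2
      then have "P (branch y n) (\<lambda>t. 0)"
        using locally_simple_zero by (simp add: P_def harmonic_def max_absorb1)
      then show ?thesis by blast
    qed
  next
    fix s assume "\<exists>A. P (s @ [False]) A" "\<exists>A. P (s @ [True]) A"
    then have "\<forall>b. \<exists>A. P (s @ [b]) A" by (metis (full_types))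
    then obtain A where A: "\<And>b. P (s @ [b]) (A b)" by metis
    \<comment> \<open>Harmonicity forces the root value to be the mean of the values at the two
      children.\<close>
    define A' where "A' t = (case t of [] \<Rightarrow> (A False [] + A True []) / 2 | b # u \<Rightarrow> A b u)" for t
    have A'[simp]: "A' [] = (A False [] + A True []) / 2" "A' (b # u) = A b u" for b u
      by (simp_all add: A'_def)
    have harm: "A' (t @ [False]) + A' (t @ [True]) = 2 * A' t" for t
      using A by (cases t) (auto simp: P_def harmonic_def)
    have ls: "locally_simple A' (\<lambda>t. max 0 (h (s @ t)))"
      by (rule locally_simple_glue) (use A in \<open>simp add: P_def\<close>)
    have ge: "0 \<le> A b u \<and> F (s @ b # u) \<le> A b u" for b u
      using A[of b] unfolding P_def by simp
    have up: "0 \<le> A' t \<and> F (s @ t) \<le> A' t" for t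
    proof (cases t)
      case Nil
      have "F (s @ [False]) + F (s @ [True]) = 2 * F s" using F by (simp add: harmonic_def)
      then show ?thesis using Nil ge[of False "[]"] ge[of True "[]"] by simp
    qed (use ge in simp)
    have least: "A' t \<le> B t" if B: "harmonic B" "\<forall>t. 0 \<le> B t \<and> F (s @ t) \<le> B t" for B t
    proof -
      have b: "A b u \<le> B (b # u)" for b u
      proof -
        have "harmonic (\<lambda>t. B (b # t))" using harmonic_shift[OF B(1), of "[b]"] by simp
        moreover have "\<forall>t. 0 \<le> B (b # t) \<and> F ((s @ [b]) @ t) \<le> B (b # t)" using B(2) by simp
        ultimately show ?thesis using A[of b] unfolding P_def by blast
      qed
      show ?thesis
      proof (cases t)
        case Nil
        have "B [False] + B [True] = 2 * B []" using B(1) by (metis harmonic_def append_Nil)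
        then show ?thesis using Nil b[of False "[]"] b[of True "[]"] by simp
      qed (use b in simp)
    qed
    show "\<exists>A. P s A" using harm ls up least unfolding P_def harmonic_def by blast
  qed
  then show thesis using that by (auto simp: P_def)
qed

text \<open>The two components, both indexed by tree nodes, are packed into one function on \<open>nat\<close>.\<close>

definition coordinate :: "nat \<Rightarrow> bool list + bool list" where
  "coordinate = from_nat_into UNIV"

lemma bij_coordinate: "bij coordinate"
  unfolding coordinate_def
  by (rule bij_betw_from_nat_into) (auto simp: infinite_UNIV_listI)

text \<open>The component on the Cantor space, given by its averages over cones; \<open>atom\<close>
  is the component on the isolated nodes.\<close>

definition dens :: "(nat \<Rightarrow> real) \<Rightarrow> bool list \<Rightarrow> real" where
  "dens X s = X (inv_into UNIV coordinate (Inl s))"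

definition atom :: "(nat \<Rightarrow> real) \<Rightarrow> bool list \<Rightarrow> real" where
  "atom X s = X (inv_into UNIV coordinate (Inr s))"

definition combine :: "(bool list \<Rightarrow> real) \<Rightarrow> (bool list \<Rightarrow> real) \<Rightarrow> nat \<Rightarrow> real" where
  "combine F h n = case_sum F h (coordinate n)"

lemma dens_combine [simp]: "dens (combine F h) = F"
  and atom_combine [simp]: "atom (combine F h) = h"
  by (simp_all add: fun_eq_iff dens_def atom_def combine_def
      surj_f_inv_f[OF bij_is_surj[OF bij_coordinate]])

lemma le_iff_dens_atom: "X \<le> Z \<longleftrightarrow> (\<forall>s. dens X s \<le> dens Z s) \<and> (\<forall>s. atom X s \<le> atom Z s)"
proof
  assume *: "(\<forall>s. dens X s \<le> dens Z s) \<and> (\<forall>s. atom X s \<le> atom Z s)"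
  show "X \<le> Z"
  proof (rule le_funI)
    fix n show "X n \<le> Z n"
      using * inv_f_f[OF bij_is_inj[OF bij_coordinate], of n]
      unfolding dens_def atom_def by (cases "coordinate n") metis+
  qed
qed (simp add: le_fun_def dens_def atom_def)

lemma dens_zero [simp]: "dens (\<lambda>i. 0) = (\<lambda>s. 0)"
  and atom_zero [simp]: "atom (\<lambda>i. 0) = (\<lambda>s. 0)"
  by (simp_all add: dens_def atom_def fun_eq_iff)

lemma eq_zeroI:
  assumes "\<And>s. dens X s = 0" "\<And>s. atom X s = 0"
  shows "X = (\<lambda>n. 0)"
  using assms by (intro antisym) (simp_all add: le_iff_dens_atom)

definition tree_group :: "(nat \<Rightarrow> real) set" where
  "tree_group = {X. harmonic (dens X) \<and> locally_simple (dens X) (atom X)}"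

lemma combine_in_tree_group: "harmonic F \<Longrightarrow> locally_simple F h \<Longrightarrow> combine F h \<in> tree_group"
  by (simp add: tree_group_def)

interpretation tree: pointwise_l_group tree_group
proof
  show "(\<lambda>i. 0) \<in> tree_group"
    using locally_simple_zero by (simp add: tree_group_def harmonic_def)
next
  fix X Z assume "X \<in> tree_group" "Z \<in> tree_group"
  moreover have "dens (\<lambda>i. X i - Z i) = (\<lambda>t. dens X t - dens Z t)"
    "atom (\<lambda>i. X i - Z i) = (\<lambda>t. atom X t - atom Z t)"
    by (simp_all add: dens_def atom_def fun_eq_iff)
  ultimately show "(\<lambda>i. X i - Z i) \<in> tree_group"
    using locally_simple_lincomb[of "dens X" "atom X" "dens Z" "atom Z" 1 "-1"]
    by (auto simp: tree_group_def harmonic_def algebra_simps)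
next
  fix X assume X: "X \<in> tree_group"
  then obtain A where A: "harmonic A" "locally_simple A (\<lambda>t. max 0 (atom X t))"
    "\<And>t. 0 \<le> A t" "\<And>t. dens X t \<le> A t"
    "\<And>B t. \<lbrakk>harmonic B; \<And>t. 0 \<le> B t; \<And>t. dens X t \<le> B t\<rbrakk> \<Longrightarrow> A t \<le> B t"
    using locally_simple_positive_part[of "dens X" "atom X"] by (metis (mono_tags, lifting) tree_group_def mem_Collect_eq)
  show "\<exists>p\<in>tree_group. (\<lambda>i. 0) \<le> p \<and> X \<le> p \<and>
      (\<forall>q\<in>tree_group. (\<lambda>i. 0) \<le> q \<and> X \<le> q \<longrightarrow> p \<le> q)"
    using A combine_in_tree_group[OF A(1,2)]
    by (intro bexI[of _ "combine A (\<lambda>t. max 0 (atom X t))"])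
      (auto simp: le_iff_dens_atom tree_group_def)
qed

section \<open>Double polars and the bound needed for (M)\<close>

lemma tree_group_nonneg_iff:
  "(\<lambda>i. 0) \<le> X \<longleftrightarrow> (\<forall>s. 0 \<le> dens X s) \<and> (\<forall>s. 0 \<le> atom X s)"
  by (simp add: le_iff_dens_atom)

text \<open>The indicator of a single node tests the node component there. If the value of
  \<open>d\<close> at \<open>s\<close> is positive, the multiple by \<open>r\<close> is a nonzero
  element below both.\<close>

lemma disjoint_atom:
  assumes "(\<lambda>i. 0) \<le> d" "d \<in> tree_group"
  shows "disjoint_in tree_group (combine (\<lambda>t. 0) (\<lambda>t. if t = s then 1 else 0)) d \<longleftrightarrow> atom d s = 0"
    (is "disjoint_in _ ?e d \<longleftrightarrow> _")
proof
  assume *: "disjoint_in tree_group ?e d"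
  define r where "r = min 1 (atom d s)"
  let ?q = "combine (\<lambda>t. 0) (\<lambda>t. r * (if t = s then 1 else 0))"
  have "locally_simple (\<lambda>t. 0) (\<lambda>t. r * (if t = s then 1 else 0))"
    using locally_simple_lincomb[OF locally_simple_atom[of s] locally_simple_zero, of r 0] by simp
  then have "?q \<in> tree_group" by (intro combine_in_tree_group) (auto simp: harmonic_def)
  moreover have "(\<lambda>i. 0) \<le> ?q \<and> ?q \<le> ?e \<and> ?q \<le> d"
    using assms(1) by (auto simp: tree_group_nonneg_iff le_iff_dens_atom r_def)
  ultimately have "?q = (\<lambda>i. 0)" using * by (auto simp: disjoint_in_def)
  then have "atom ?q s = 0" by (simp only: atom_zero)
  then have "r = 0" by simp
  then show "atom d s = 0" by (auto simp: r_def min_def split: if_splits)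
next
  assume *: "atom d s = 0"
  show "disjoint_in tree_group ?e d" unfolding disjoint_in_def
  proof (intro ballI impI, elim conjE)
    fix q assume q: "(\<lambda>i. 0) \<le> q" "q \<le> ?e" "q \<le> d"
    show "q = (\<lambda>i. 0)"
    proof (rule eq_zeroI)
      fix t
      show "dens q t = 0" using q(1,2) by (auto simp: tree_group_nonneg_iff le_iff_dens_atom intro: antisym)
      have "0 \<le> atom q t" "atom q t \<le> (if t = s then 1 else 0)" "atom q t \<le> atom d t"
        using q by (auto simp: tree_group_nonneg_iff le_iff_dens_atom)
      then show "atom q t = 0" using * by (auto split: if_splits)
    qed
  qed
qed

text \<open>Where the density of \<open>d\<close> is constant on a cone, the indicator of that cone
  tests whether the constant is zero; the smaller of 1 and \<open>c\<close>, times the indicator, is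
  the common lower bound.\<close>

lemma disjoint_cone:
  assumes d: "(\<lambda>i. 0) \<le> d" "d \<in> tree_group" and c: "\<And>t. dens d (s @ t) = c"
  shows "disjoint_in tree_group (combine (cone s) (\<lambda>t. 0)) d \<longleftrightarrow> c = 0"
    (is "disjoint_in _ ?e d \<longleftrightarrow> _")
proof
  assume *: "disjoint_in tree_group ?e d"
  have c0: "0 \<le> c" using c d(1) by (metis tree_group_nonneg_iff)
  define r where "r = min 1 c"
  let ?q = "combine (\<lambda>t. r * cone s t) (\<lambda>t. 0)"
  have h: "harmonic (\<lambda>t. r * cone s t)"
    using harmonic_cone[of s] by (auto simp: harmonic_def algebra_simps simp flip: distrib_left)
  have "locally_simple (\<lambda>t. r * cone s t) (\<lambda>t. 0)"
    using locally_simple_lincomb[OF locally_simple_cone[of s] locally_simple_zero, of r 0] by simp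
  then have "?q \<in> tree_group" using h by (intro combine_in_tree_group)
  moreover have r: "0 \<le> r" "r \<le> 1" "r \<le> c" using c0 by (auto simp: r_def)
  have "r * cone s t \<le> dens d t" for t
  \<comment> \<open>The comparison is clear on and off the cone of \<open>s\<close>;
    \<open>harmonic_le\<close> carries it to the nodes above \<open>s\<close>, whose averages mix
    both.\<close>
  proof (rule harmonic_le[OF h])
    show "harmonic (dens d)" using d(2) by (simp add: tree_group_def)
    fix y
    have "r * cone s (branch y (length s) @ t) \<le> dens d (branch y (length s) @ t)" for t
    proof (cases "s = branch y (length s)")
      case True
      then show ?thesis using c[of t] cone_above[of s t] r(3) by simp
    next
      case False
      then show ?thesis using cone_incomparable[of s "branch y (length s)" t] d(1)
        by (simp add: tree_group_nonneg_iff)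
    qed
    then show "\<exists>n. \<forall>t. r * cone s (branch y n @ t) \<le> dens d (branch y n @ t)" by blast
  qed
  then have "(\<lambda>i. 0) \<le> ?q \<and> ?q \<le> ?e \<and> ?q \<le> d"
    using d(1) r cone_nonneg[of s] mult_right_mono[OF r(2) cone_nonneg[of s]]
    by (auto simp: tree_group_nonneg_iff le_iff_dens_atom)
  ultimately have "?q = (\<lambda>i. 0)" using * by (auto simp: disjoint_in_def)
  then have "dens ?q (s @ []) = 0" by (simp only: dens_zero)
  then have "r = 0" using cone_above[of s "[]"] by simp
  then show "c = 0" by (auto simp: r_def min_def split: if_splits)
next
  assume *: "c = 0"
  show "disjoint_in tree_group ?e d" unfolding disjoint_in_def
  proof (intro ballI impI, elim conjE)
    fix q assume q: "q \<in> tree_group" "(\<lambda>i. 0) \<le> q" "q \<le> ?e" "q \<le> d"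
    have q': "0 \<le> dens q t" "dens q t \<le> cone s t" "dens q t \<le> dens d t" 
      "0 \<le> atom q t" "atom q t \<le> 0" for t
      using q by (auto simp: tree_group_nonneg_iff le_iff_dens_atom)
    have le: "dens q t \<le> 0" for t
    \<comment> \<open>On the cone of \<open>s\<close> the density of \<open>q\<close> is bounded by
      that of \<open>d\<close>, which is zero there; on the other cones of the same depth it is
      bounded by the vanishing indicator.\<close>
    proof (rule harmonic_le)
      show "harmonic (dens q)" using q(1) by (simp add: tree_group_def)
      show "harmonic (\<lambda>t. 0)" by (simp add: harmonic_def)
      fix y
      have "dens q (branch y (length s) @ t) \<le> 0" for t
      proof (cases "s = branch y (length s)")
        case True
        then show ?thesis using c[of t] q'(3) * by metis
      next
        case False
        then show ?thesis
          using cone_incomparable[of s "branch y (length s)" t] q'(2)[of "branch y (length s) @ t"] by simp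
      qed
      then show "\<exists>n. \<forall>t. dens q (branch y n @ t) \<le> 0" by blast
    qed
    show "q = (\<lambda>i. 0)"
      by (rule eq_zeroI) (use le q' in \<open>auto intro: antisym\<close>)
  qed
qed

text \<open>Near \<open>y\<close> a pole of \<open>a\<close> dominates every possible behaviour of
  \<open>d\<close>. If \<open>a\<close> has no pole at \<open>y\<close>, its double polar admits
  none either, and two constants are compared. Bar induction then yields one multiple for the whole
  tree.\<close>

lemma tree_group_dominated:
  assumes a: "a \<in> tree_group" "(\<lambda>i. 0) \<le> a" and d: "d \<in> tree_group" "(\<lambda>i. 0) \<le> d"
    and disj: "\<And>p. \<lbrakk>p \<in> tree_group; (\<lambda>i. 0) \<le> p; disjoint_in tree_group p a\<rbrakk>
      \<Longrightarrow> disjoint_in tree_group p d"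
  shows "\<exists>n::nat. d \<le> (\<lambda>i. real n * a i)"
proof -
  have a0: "0 \<le> dens a t" "0 \<le> atom a t" and d0: "0 \<le> dens d t" "0 \<le> atom d t" for t
    using a(2) d(2) by (auto simp: tree_group_nonneg_iff)
  have atom0: "atom d s = 0" if "atom a s = 0" for s
  proof -
    let ?e = "combine (\<lambda>t. 0) (\<lambda>t. if t = s then 1 else 0)"
    have "?e \<in> tree_group"
      by (intro combine_in_tree_group locally_simple_atom) (simp add: harmonic_def)
    moreover have "(\<lambda>i. 0) \<le> ?e" by (simp add: tree_group_nonneg_iff)
    ultimately show ?thesis
      using disj[of ?e] disjoint_atom[OF a(2,1)] disjoint_atom[OF d(2,1)] that by blast
  qed
  have cone0: "c' = 0" if "\<And>t. dens a (s @ t) = 0" "\<And>t. dens d (s @ t) = c'" for s c'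
  proof -
    let ?e = "combine (cone s) (\<lambda>t. 0)"
    have "?e \<in> tree_group"
      by (intro combine_in_tree_group locally_simple_cone harmonic_cone)
    moreover have "(\<lambda>i. 0) \<le> ?e" by (simp add: tree_group_nonneg_iff cone_nonneg)
    ultimately show ?thesis
      using disj[of ?e] disjoint_cone[OF a(2,1) that(1)] disjoint_cone[OF d(2,1) that(2)] by blast
  qed
  define P where "P s k \<longleftrightarrow> (\<forall>t. dens d (s @ t) \<le> real k * dens a (s @ t) \<and>
      atom d (s @ t) \<le> real k * atom a (s @ t))" for s and k :: nat
  have P_mono: "P s k'" if "P s k" "k \<le> k'" for s k k'
  proof -
    have "real k * dens a t \<le> real k' * dens a t" "real k * atom a t \<le> real k' * atom a t" for t
      using that(2) a0 by (auto intro!: mult_right_mono)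
    then show ?thesis using that(1) unfolding P_def by (meson order_trans)
  qed
  have "\<exists>k. P [] k"
  proof (rule bar_induct[of "\<lambda>s. \<exists>k. P s k"])
    fix y
    obtain n1 c r where 1:
      "\<And>k t. n1 \<le> k \<Longrightarrow> dens a (branch y k @ t) = c + r * pole y (branch y k @ t)"
      "\<And>k t. n1 \<le> k \<Longrightarrow> atom a (branch y k @ t) = r * pole_atom y (branch y k @ t)"
      using locally_simpleE[of "dens a" "atom a" y] a(1) unfolding tree_group_def mem_Collect_eq by metis
    obtain n2 c' r' where 2:
      "\<And>k t. n2 \<le> k \<Longrightarrow> dens d (branch y k @ t) = c' + r' * pole y (branch y k @ t)"
      "\<And>k t. n2 \<le> k \<Longrightarrow> atom d (branch y k @ t) = r' * pole_atom y (branch y k @ t)"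
      using locally_simpleE[of "dens d" "atom d" y] d(1) unfolding tree_group_def mem_Collect_eq by metis
    \<comment> \<open>The node \<open>branch y k\<close> lies on the branch of \<open>y\<close>, so
      the atom value there is the strength of the pole; nonnegative elements have nonnegative
      strengths.\<close>
    have at: "pole_atom y (branch y k @ []) = 1" for k
      unfolding pole_atom_above by simp
    have r: "0 \<le> r" using 1(2)[of n1 "[]"] a0(2) at by (metis mult.right_neutral order_refl)
    have r': "0 \<le> r'" using 2(2)[of n2 "[]"] d0(2) at by (metis mult.right_neutral order_refl)
    let ?m = "max n1 n2"
    show "\<exists>n k. P (branch y n) k"
    proof (cases "r = 0")
      case True
      \<comment> \<open>Here the node component does its work: vanishing of \<open>a\<close> at one
        deep node of the branch passes to \<open>d\<close> and excludes a pole of \<open>d\<close>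
        at \<open>y\<close>.\<close>
      have "atom a (branch y ?m @ []) = 0" using 1(2)[of ?m "[]"] True by simp
      then have r'0: "r' = 0" using atom0 2(2)[of ?m "[]"] at[of ?m] by simp
      have ac: "dens a (branch y ?m @ t) = c" and dc: "dens d (branch y ?m @ t) = c'" for t
        using 1(1)[of ?m t] 2(1)[of ?m t] True r'0 by auto
      have "0 \<le> c" using ac a0 by metis
      moreover have "c' = 0" if "c = 0" using cone0 ac dc that by blast
      ultimately obtain k :: nat where "c' \<le> real k * c"
        using ex_less_of_nat_mult[of c c']
        by (metis less_eq_real_def mult_zero_right order_refl)
      then have "P (branch y ?m) k"
        unfolding P_def using ac dc 1(2)[of ?m] 2(2)[of ?m] True r'0 by simp
      then show ?thesis by blast
    next
      case False
      with r have r0: "0 < r" by simp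
      \<comment> \<open>With \<open>x\<close> the value of the pole, depth \<open>j\<close> makes
        the density of \<open>a\<close> at least \<open>x * (r / 2)\<close>, and the extra level in
        \<open>Suc j\<close> ensures that \<open>x\<close> is at least 1, so that the density of
        \<open>d\<close> is at most \<open>(\<bar>c'\<bar> + r') * x\<close>. The choice of
        \<open>k\<close> compares these bounds.\<close>
      obtain j :: nat where j: "\<bar>c\<bar> < real j * (r / 2)" using ex_less_of_nat_mult[of "r/2" "\<bar>c\<bar>"] r0 by auto
      define n where "n = max ?m (Suc j)"
      have n: "n1 \<le> n" "n2 \<le> n" "Suc j \<le> n" by (auto simp: n_def)
      obtain k :: nat where k: "\<bar>c'\<bar> + r' < real k * (r / 2)"
        using ex_less_of_nat_mult[of "r/2" "\<bar>c'\<bar> + r'"] r0 by auto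
      have "dens d (branch y n @ t) \<le> real k * dens a (branch y n @ t) \<and>
        atom d (branch y n @ t) \<le> real k * atom a (branch y n @ t)" for t
      proof
        define x where "x = pole y (branch y n @ t)"
        have x: "real j \<le> x" "1 \<le> x"
          using pole_above[of y n t] pole_nonneg[of "\<lambda>i. y (n + i)" t] n(3) by (auto simp: x_def)
        have "real j * (r / 2) \<le> x * (r / 2)" using x r0 by (intro mult_right_mono) auto
        then have "x * (r / 2) \<le> c + r * x" using j by (simp add: algebra_simps)
        then have "real k * (x * (r / 2)) \<le> real k * (c + r * x)" by (intro mult_left_mono) auto
        moreover have "(\<bar>c'\<bar> + r') * x \<le> (real k * (r / 2)) * x"
          using k x by (intro mult_right_mono) auto
        moreover have "c' + r' * x \<le> (\<bar>c'\<bar> + r') * x"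
          using mult_left_mono[OF x(2), of "\<bar>c'\<bar>"] by (simp add: algebra_simps)
        ultimately have "c' + r' * x \<le> real k * (c + r * x)" by (simp add: algebra_simps)
        then show "dens d (branch y n @ t) \<le> real k * dens a (branch y n @ t)"
          by (simp only: 1(1)[OF n(1)] 2(1)[OF n(2)] x_def)
        have "0 \<le> real k * (r / 2)" using r0 by simp
        then have "r' \<le> real k * r" using k by linarith
        then have "r' * pole_atom y (branch y n @ t) \<le> (real k * r) * pole_atom y (branch y n @ t)"
          by (intro mult_right_mono pole_atom_nonneg)
        then show "atom d (branch y n @ t) \<le> real k * atom a (branch y n @ t)"
          by (simp only: 1(2)[OF n(1)] 2(2)[OF n(2)] mult.assoc)
      qed
      then show ?thesis unfolding P_def by blast
    qed
  next
    fix s assume "\<exists>k. P (s @ [False]) k" "\<exists>k. P (s @ [True]) k"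
    then obtain k1 k2 where "P (s @ [False]) k1" "P (s @ [True]) k2" by blast
    \<comment> \<open>The subtrees of the children do not contain \<open>s\<close>, so its own atom
      value needs a separate multiple.\<close>
    moreover obtain k3 :: nat where k3: "atom d s \<le> real k3 * atom a s"
      using ex_less_of_nat_mult[of "atom a s" "atom d s"] atom0[of s] a0(2)[of s]
      by (metis less_eq_real_def mult_zero_right order_refl)
    define k where "k = max k3 (max k1 k2)"
    ultimately have P: "P (s @ [False]) k" "P (s @ [True]) k" by (auto intro: P_mono)
    have k: "atom d s \<le> real k * atom a s"
      using k3 mult_right_mono[OF _ a0(2)[of s], of "real k3" "real k"] by (simp add: k_def)
    have "dens d (s @ [b]) \<le> real k * dens a (s @ [b])" for b
      using P unfolding P_def by (cases b) (metis append_Nil2)+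
    moreover have "dens d (s @ [False]) + dens d (s @ [True]) = 2 * dens d s"
      "dens a (s @ [False]) + dens a (s @ [True]) = 2 * dens a s"
      using a(1) d(1) by (auto simp: tree_group_def harmonic_def)
    ultimately have "2 * dens d s \<le> real k * (2 * dens a s)"
      by (metis add_mono distrib_left)
    then have kd: "dens d s \<le> real k * dens a s" by simp
    have "P s k" unfolding P_def
    proof
      fix t
      show "dens d (s @ t) \<le> real k * dens a (s @ t) \<and> atom d (s @ t) \<le> real k * atom a (s @ t)"
      proof (cases t)
        case (Cons b u)
        then show ?thesis using P unfolding P_def by (cases b) auto
      qed (use k kd in simp)
    qed
    then show "\<exists>k. P s k" ..
  qed
  then obtain k where "P [] k" ..
  then have "d \<le> (\<lambda>i. real k * a i)"
    by (simp add: P_def le_iff_dens_atom) (simp add: dens_def atom_def)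
  then show ?thesis ..
qed

section \<open>The constant one in maximal convex l-subgroups\<close>

lemma one_in_maximal:
  assumes M: "maximal_convex_l_subgroup (pointwise_group tree_group) M"
  shows "combine (cone []) (\<lambda>t. 0) \<in> M"
proof (rule ccontr)
  let ?u = "\<lambda>s. combine (cone s) (\<lambda>t. 0)"
  assume notin: "?u [] \<notin> M"
  have M': "convex_l_subgroup (pointwise_group tree_group) M"
    using M by (auto simp: maximal_convex_l_subgroup_def)
  have uC: "?u s \<in> tree_group" for s
    by (intro combine_in_tree_group locally_simple_cone harmonic_cone)
  have u0: "(\<lambda>i. 0) \<le> ?u s" for s by (simp add: tree_group_nonneg_iff cone_nonneg)
  have "?u [] \<in> M"
  \<comment> \<open>The indicator of a cone is the sum of those of its two halves, so it remains to
    find, for each \<open>y\<close>, a cone around \<open>y\<close> whose indicator lies in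
    \<open>M\<close>.\<close>
  proof (rule bar_induct[of "\<lambda>s. ?u s \<in> M"])
    fix s assume "?u (s @ [False]) \<in> M" "?u (s @ [True]) \<in> M"
    then have "(\<lambda>i. ?u (s @ [False]) i + ?u (s @ [True]) i) \<in> M"
      by (rule tree.convex_add[OF M'])
    also have "(\<lambda>i. ?u (s @ [False]) i + ?u (s @ [True]) i) = ?u s"
      by (auto simp: combine_def fun_eq_iff cone_singletons split: sum.split)
    finally show "?u s \<in> M" .
  next
    fix y
    \<comment> \<open>A bounded multiple of the constant one cannot dominate a pole, so the summand
      \<open>m\<close> must be large near \<open>y\<close>.\<close>
    have "combine (pole y) (pole_atom y) \<in> tree_group"
      by (intro combine_in_tree_group harmonic_pole locally_simple_pole)
    then obtain m and k :: nat where m: "m \<in> M" "(\<lambda>i. 0) \<le> m"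
      and le: "combine (pole y) (pole_atom y) \<le> (\<lambda>i. m i + real k * ?u [] i)"
      using tree.maximal_dominates[OF M uC u0 notin] by blast
    have mC: "m \<in> tree_group" using tree.convex_subset[OF M'] m(1) by auto
    have m0: "0 \<le> dens m t" "0 \<le> atom m t" for t using m(2) by (auto simp: tree_group_nonneg_iff)
    have "dens (\<lambda>i. m i + real k * ?u [] i) t = dens m t + real k * dens (?u []) t" for t
      by (simp only: dens_def)
    then have le': "pole y t \<le> dens m t + real k" for t
      using le by (simp add: le_iff_dens_atom)
    \<comment> \<open>At depth \<open>Suc k\<close> the pole is at least \<open>k + 1\<close>, which
      leaves at least 1 for the density of \<open>m\<close> on this cone.\<close>
    let ?s = "branch y (Suc k)"
    have "cone ?s t \<le> dens m t" for t
    proof (rule harmonic_le[OF harmonic_cone])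
      show "harmonic (dens m)" using mC by (simp add: tree_group_def)
      fix z
      have "cone ?s (branch z (Suc k) @ t) \<le> dens m (branch z (Suc k) @ t)" for t
      proof (cases "?s = branch z (Suc k)")
        case True
        have "1 \<le> dens m (?s @ t)"
          using le'[of "?s @ t"] pole_above[of y "Suc k" t] pole_nonneg[of "\<lambda>i. y (Suc k + i)" t]
          by linarith
        then show ?thesis using cone_le_one True by (metis order_trans)
      next
        case False
        then show ?thesis using cone_incomparable[OF _ False] m0 by (simp del: upt_Suc)
      qed
      then show "\<exists>n. \<forall>t. cone ?s (branch z n @ t) \<le> dens m (branch z n @ t)" by blast
    qed
    then have "?u ?s \<le> m" using m0 by (simp add: le_iff_dens_atom del: upt_Suc)
    then have "?u ?s \<in> M"
      by (rule tree.convex_mem[OF M' tree.convex_zero[OF M'] m(1) uC u0])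
    then show "\<exists>n. ?u (branch y n) \<in> M" by blast
  qed
  then show False using notin by simp
qed

theorem mainTheorem11:
  shows "\<exists>G :: (nat \<Rightarrow> real) lgroup.
    l_group G \<and> archimedean G \<and> property_M G \<and> \<not> property_Y G"
proof (intro exI conjI)
  let ?u = "combine (cone []) (\<lambda>t. 0)"
  show "l_group (pointwise_group tree_group)" by (rule tree.l_group_axioms)
  show "archimedean (pointwise_group tree_group)" by (rule tree.archimedean)
  show "property_M (pointwise_group tree_group)"
    by (intro tree.property_M_criterion tree_group_dominated)
  show "\<not> property_Y (pointwise_group tree_group)"
  proof (rule tree.not_property_Y_criterion[OF _ _ _ one_in_maximal])
    show "?u \<in> tree_group"
      by (intro combine_in_tree_group locally_simple_cone harmonic_cone)
    show "(\<lambda>i. 0) \<le> ?u" by (simp add: tree_group_nonneg_iff cone_nonneg)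
    have "dens ?u [] \<noteq> dens (\<lambda>i. 0) []" by simp
    then show "?u \<noteq> (\<lambda>i. 0)" by metis
  qed
qed

end
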